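(* Let $m=2$, let $A_0\in\mathbb{R}^{n\times n}$ be symmetric, let $E,B\in\mathbb{R}^{n\times n}$ be symmetric positive definite, let $a_1,a_2\in\mathbb{R}^n$, and let $G(\lambda),H(\lambda)\in\mathbb{R}^{2\times2}$ and the reduced system (R) be as in the context. Suppose that $D\subset\mathbb{R}$ is a neighborhood of a point $\tilde\lambda$ and that $\mu_1,\mu_2:D\to\mathbb{R}$ are the implicitly defined continuous functions described in the context (so that $(\lambda,\mu_1(\lambda),\mu_2(\lambda))$ satisfies (R) for all $\lambda\in D$), and let $\lambda\in D$ be given. Denote by $h_{ij}$ and $g_{ij}$ the element $(i,j)$ of $H(\lambda)$ and $G(\lambda)$, respectively. Then $\gamma:=\mu_1^2(\lambda)$ satisfies the degree-three polynomial equation $$\gamma^3\big[h_{12}^2g_{11}-2h_{12}h_{11}g_{12}+h_{11}^2g_{22}\big]+\gamma^2\big[2h_{12}g_{12}-2h_{11}g_{22}\big]+\gamma g_{22}-h_{12}^2=0,$$ and $\mu_2=\mu_2(\lambda)$ satisfies, with $\mu_1=\mu_1(\lambda)$, the equation $$\mu_1-h_{11}\mu_1^3=h_{12}\mu_2^3 .$$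
   Context: Put $A_2:=[a_1,a_2]\in\mathbb{R}^{n\times 2}$ and, for $\lambda$ not an eigenvalue of the pencil $A_0-\lambda E$, $$G(\lambda):=A_2^T(\lambda E-A_0)^{-1}B(\lambda E-A_0)^{-1}A_2,\qquad H(\lambda):=A_2^T(\lambda E-A_0)^{-1}A_2 .$$ For a vector $\mu=[\mu_1,\mu_2]^T$, $\mu^p$ denotes element-wise exponentiation. With $P=[\,1\;\;0\,]$ (discarding the last component), the reduced system (R) is $$(\mu^3)^TG(\lambda)\mu^3-1=0,\qquad P\big(H(\lambda)\mu^3-\mu\big)=0 .$$ The functions $\mu_1,\mu_2$ arise as follows: $(\tilde\lambda,\tilde\mu)\in\mathbb{R}\times\mathbb{R}^2$ is a solution of (R) at which the Jacobian of (R) with respect to $\mu$ is nonsingular, and $\mu(\lambda)=[\mu_1(\lambda),\mu_2(\lambda)]^T$ is the function given by the implicit function theorem, continuous in the neighborhood $D$ of $\tilde\lambda$, with $\mu(\tilde\lambda)=\tilde\mu$ and $(\lambda,\mu(\lambda))$ satisfying (R) for all $\lambda\in D$. *)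

theory Defs
  imports "HOL-Analysis.Analysis"
begin

definition symmetric_matrix :: "real^'n^'n \<Rightarrow> bool"
  where "symmetric_matrix A \<longleftrightarrow> transpose A = A"

definition sym_pos_def :: "real^'n^'n \<Rightarrow> bool"
  where "sym_pos_def A \<longleftrightarrow> symmetric_matrix A \<and> (\<forall>x. x \<noteq> 0 \<longrightarrow> 0 < x \<bullet> (A *v x))"

definition pencil_eigenvalue :: "real^'n^'n \<Rightarrow> real^'n^'n \<Rightarrow> real \<Rightarrow> bool"
  where "pencil_eigenvalue A0 E l \<longleftrightarrow> (\<exists>x. x \<noteq> 0 \<and> A0 *v x = l *\<^sub>R (E *v x))"

(* vector [a1, a2] has a1, a2 as rows; the transpose turns them into columns. *)
definition A2 :: "real^'n \<Rightarrow> real^'n \<Rightarrow> real^2^'n"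
  where "A2 a1 a2 = transpose (vector [a1, a2])"

(* The pencil resolvent, and hence G and H below, is meaningful only when l is
   not an eigenvalue of the pencil; matrix_inv is unspecified otherwise. *)
definition resolvent :: "real^'n^'n \<Rightarrow> real^'n^'n \<Rightarrow> real \<Rightarrow> real^'n^'n"
  where "resolvent A0 E l = matrix_inv (l *\<^sub>R E - A0)"

definition G :: "real^'n^'n \<Rightarrow> real^'n^'n \<Rightarrow> real^'n^'n \<Rightarrow> real^'n \<Rightarrow> real^'n \<Rightarrow> real \<Rightarrow> real^2^2"
  where "G A0 E B a1 a2 l =
    transpose (A2 a1 a2) ** resolvent A0 E l ** B ** resolvent A0 E l ** A2 a1 a2"

definition H :: "real^'n^'n \<Rightarrow> real^'n^'n \<Rightarrow> real^'n \<Rightarrow> real^'n \<Rightarrow> real \<Rightarrow> real^2^2"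
  where "H A0 E a1 a2 l = transpose (A2 a1 a2) ** resolvent A0 E l ** A2 a1 a2"

definition elem_pow :: "real^'k \<Rightarrow> nat \<Rightarrow> real^'k"
  where "elem_pow u p = (\<chi> i. (u $ i) ^ p)"

(* The 1-by-2 matrix [1 0]. *)
definition P :: "real^2^1"
  where "P = vector [vector [1, 0]]"

definition R_scalar ::
  "real^'n^'n \<Rightarrow> real^'n^'n \<Rightarrow> real^'n^'n \<Rightarrow> real^'n \<Rightarrow> real^'n \<Rightarrow> real \<Rightarrow> real^2 \<Rightarrow> real"
  where "R_scalar A0 E B a1 a2 l u =
    elem_pow u 3 \<bullet> (G A0 E B a1 a2 l *v elem_pow u 3) - 1"

definition R_proj ::
  "real^'n^'n \<Rightarrow> real^'n^'n \<Rightarrow> real^'n \<Rightarrow> real^'n \<Rightarrow> real \<Rightarrow> real^2 \<Rightarrow> real^1"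
  where "R_proj A0 E a1 a2 l u = P *v (H A0 E a1 a2 l *v elem_pow u 3 - u)"

definition solves_R ::
  "real^'n^'n \<Rightarrow> real^'n^'n \<Rightarrow> real^'n^'n \<Rightarrow> real^'n \<Rightarrow> real^'n \<Rightarrow> real \<Rightarrow> real^2 \<Rightarrow> bool"
  where "solves_R A0 E B a1 a2 l u \<longleftrightarrow>
    \<not> pencil_eigenvalue A0 E l \<and> R_scalar A0 E B a1 a2 l u = 0 \<and> R_proj A0 E a1 a2 l u = 0"

(* Both residuals stacked into one vector, so that the Jacobian in u is a 2-by-2 matrix. *)
definition R_map ::
  "real^'n^'n \<Rightarrow> real^'n^'n \<Rightarrow> real^'n^'n \<Rightarrow> real^'n \<Rightarrow> real^'n \<Rightarrow> real \<Rightarrow> real^2 \<Rightarrow> real^2"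
  where "R_map A0 E B a1 a2 l u = vector [R_scalar A0 E B a1 a2 l u, R_proj A0 E a1 a2 l u $ 1]"

end

theory Submission
  imports Defs
begin

text \<open>
  Write \<open>\<mu>\<^sub>1\<close>, \<open>\<mu>\<^sub>2\<close> for the components of \<open>\<mu>(\<lambda>)\<close>. The projected half of the reduced system is
  the linear relation \<open>h\<^sub>1\<^sub>1 \<mu>\<^sub>1\<^sup>3 + h\<^sub>1\<^sub>2 \<mu>\<^sub>2\<^sup>3 = \<mu>\<^sub>1\<close>, and the scalar half says that the quadratic
  form of \<open>G(\<lambda>)\<close> takes the value 1 at \<open>(\<mu>\<^sub>1\<^sup>3, \<mu>\<^sub>2\<^sup>3)\<close>. Multiplying the scalar equation by
  \<open>h\<^sub>1\<^sub>2\<^sup>2\<close> makes \<open>\<mu>\<^sub>2\<^sup>3\<close> appear only through \<open>h\<^sub>1\<^sub>2 \<mu>\<^sub>2\<^sup>3 = \<mu>\<^sub>1 - h\<^sub>1\<^sub>1 \<mu>\<^sub>1\<^sup>3\<close>, so it can be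
  eliminated without dividing by \<open>h\<^sub>1\<^sub>2\<close>. What remains involves \<open>\<mu>\<^sub>1\<close> only through
  \<open>\<mu>\<^sub>1\<^sup>6\<close>, \<open>\<mu>\<^sub>1\<^sup>4\<close> and \<open>\<mu>\<^sub>1\<^sup>2\<close>, and is therefore a cubic in \<open>\<gamma> = \<mu>\<^sub>1\<^sup>2\<close>; the calculation is
  \<open>cubic_of_eliminating_second_variable\<close>.

  The two mixed terms of the quadratic form combine into \<open>2 g\<^sub>1\<^sub>2\<close> because \<open>G(\<lambda>)\<close> is
  symmetric. This is where symmetry of \<open>A\<^sub>0\<close>, \<open>E\<close> and \<open>B\<close> enters, together with
  \<open>\<lambda>\<close> not being an eigenvalue of the pencil: it makes \<open>\<lambda>E - A\<^sub>0\<close> an invertible symmetric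
  matrix, and its inverse is then symmetric as well (\<open>symmetric_G\<close>).
\<close>

lemma transpose_diff: "transpose (A - B) = transpose A - transpose B"
  by (simp add: transpose_def vec_eq_iff)

text \<open>
  Transposing \<open>M ** X = mat 1\<close> shows that \<open>transpose X\<close> is a left inverse of \<open>M\<close>, and a left and
  a right inverse of the same matrix coincide.
\<close>

lemma symmetric_inverse:
  fixes M X :: "real^'n^'n"
  assumes M: "symmetric_matrix M" and right: "M ** X = mat 1"
  shows "symmetric_matrix X"
proof -
  have "transpose X ** M = mat 1"
    using arg_cong[OF right, of transpose] M
    by (simp add: symmetric_matrix_def matrix_transpose_mul)
  then have "transpose X = transpose X ** (M ** X)"
    by (simp add: right)
  also have "\<dots> = X"
    by (simp add: matrix_mul_assoc \<open>transpose X ** M = mat 1\<close>)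
  finally show ?thesis
    by (simp add: symmetric_matrix_def)
qed

lemma symmetric_resolvent:
  fixes A0 E :: "real^'n^'n"
  assumes A0: "symmetric_matrix A0" and E: "symmetric_matrix E"
    and regular: "\<not> pencil_eigenvalue A0 E l"
  shows "symmetric_matrix (resolvent A0 E l)"
proof -
  let ?M = "l *\<^sub>R E - A0"
  have "x = 0" if "?M *v x = 0" for x
  proof (rule ccontr)
    assume "x \<noteq> 0"
    moreover have "A0 *v x = l *\<^sub>R (E *v x)"
      using that by (simp only: matrix_vector_mult_diff_rdistrib scaleR_matrix_vector_assoc
          right_minus_eq)
    ultimately show False
      using regular by (auto simp: pencil_eigenvalue_def)
  qed
  \<comment> \<open>\<open>matrix_inv\<close> is a choice, so it has the inverse property only once an inverse is known to exist.\<close>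
  then have "\<exists>X. ?M ** X = mat 1 \<and> X ** ?M = mat 1"
    by (metis invertible_def invertible_left_inverse matrix_left_invertible_ker)
  then have "?M ** matrix_inv ?M = mat 1 \<and> matrix_inv ?M ** ?M = mat 1"
    unfolding matrix_inv_def by (rule someI_ex)
  then have "?M ** matrix_inv ?M = mat 1"
    by blast
  moreover have "symmetric_matrix ?M"
    using A0 E by (simp only: symmetric_matrix_def transpose_diff transpose_scalar)
  ultimately show ?thesis
    unfolding resolvent_def using symmetric_inverse by blast
qed

lemma symmetric_G:
  fixes A0 E B :: "real^'n^'n"
  assumes "symmetric_matrix A0" and "symmetric_matrix E" and "symmetric_matrix B"
    and "\<not> pencil_eigenvalue A0 E l"
  shows "symmetric_matrix (G A0 E B a1 a2 l)"
  using symmetric_resolvent[OF assms(1,2,4)] assms(3)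
  by (simp add: symmetric_matrix_def G_def matrix_transpose_mul matrix_mul_assoc)

lemma R_proj_eq_0_iff:
  "R_proj A0 E a1 a2 l u = 0 \<longleftrightarrow>
    H A0 E a1 a2 l $ 1 $ 1 * (u $ 1) ^ 3 + H A0 E a1 a2 l $ 1 $ 2 * (u $ 2) ^ 3 = u $ 1"
  by (simp add: R_proj_def P_def elem_pow_def matrix_vector_mult_def vec_eq_iff sum_2)

lemma R_scalar_eq_0_iff:
  assumes "symmetric_matrix (G A0 E B a1 a2 l)"
  shows "R_scalar A0 E B a1 a2 l u = 0 \<longleftrightarrow>
    G A0 E B a1 a2 l $ 1 $ 1 * ((u $ 1) ^ 3)\<^sup>2
      + 2 * G A0 E B a1 a2 l $ 1 $ 2 * (u $ 1) ^ 3 * (u $ 2) ^ 3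
      + G A0 E B a1 a2 l $ 2 $ 2 * ((u $ 2) ^ 3)\<^sup>2 = 1"
proof -
  define x y where "x = (u $ 1) ^ 3" and "y = (u $ 2) ^ 3"
  have "transpose (G A0 E B a1 a2 l) $ 1 $ 2 = G A0 E B a1 a2 l $ 1 $ 2"
    using assms by (simp only: symmetric_matrix_def)
  then have "G A0 E B a1 a2 l $ 2 $ 1 = G A0 E B a1 a2 l $ 1 $ 2"
    by (simp add: transpose_def)
  then have "R_scalar A0 E B a1 a2 l u =
      x * (G A0 E B a1 a2 l $ 1 $ 1 * x + G A0 E B a1 a2 l $ 1 $ 2 * y)
      + y * (G A0 E B a1 a2 l $ 1 $ 2 * x + G A0 E B a1 a2 l $ 2 $ 2 * y) - 1"
    by (simp add: R_scalar_def elem_pow_def matrix_vector_mult_def inner_vec_def sum_2 x_def y_def)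
  then show ?thesis
    unfolding x_def[symmetric] y_def[symmetric] by (auto simp: algebra_simps power2_eq_square)
qed

text \<open>
  Scaling the quadratic relation by \<open>h12\<^sup>2\<close> rather than solving the linear one for \<open>y\<close> keeps the
  elimination valid when \<open>h12\<close> is zero, where the linear relation leaves \<open>y\<close> free.
\<close>

lemma cubic_of_eliminating_second_variable:
  fixes x y :: "'a::comm_ring_1"
  assumes lin: "h11 * x ^ 3 + h12 * y = x"
    and quad: "g11 * (x ^ 3)\<^sup>2 + 2 * g12 * x ^ 3 * y + g22 * y\<^sup>2 = 1"
  shows "(x\<^sup>2) ^ 3 * (h12\<^sup>2 * g11 - 2 * h12 * h11 * g12 + h11\<^sup>2 * g22)
      + (x\<^sup>2)\<^sup>2 * (2 * h12 * g12 - 2 * h11 * g22) + x\<^sup>2 * g22 - h12\<^sup>2 = 0"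
proof -
  have y: "h12 * y = x - h11 * x ^ 3"
    using lin by (simp add: algebra_simps)
  have "h12\<^sup>2 = h12\<^sup>2 * (g11 * (x ^ 3)\<^sup>2 + 2 * g12 * x ^ 3 * y + g22 * y\<^sup>2)"
    by (simp only: quad mult_1_right)
  also have "\<dots> = h12\<^sup>2 * g11 * (x ^ 3)\<^sup>2 + 2 * g12 * h12 * x ^ 3 * (h12 * y) + g22 * (h12 * y)\<^sup>2"
    by (simp add: algebra_simps power2_eq_square)
  also have "\<dots> = (x\<^sup>2) ^ 3 * (h12\<^sup>2 * g11 - 2 * h12 * h11 * g12 + h11\<^sup>2 * g22)
      + (x\<^sup>2)\<^sup>2 * (2 * h12 * g12 - 2 * h11 * g22) + x\<^sup>2 * g22"
    unfolding y by (simp add: algebra_simps power2_eq_square power3_eq_cube)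
  finally show ?thesis
    by simp
qed

theorem corollary1:
  fixes A0 E B :: "real^'n^'n" and a1 a2 :: "real^'n"
    and D :: "real set" and l0 l :: real and u0 :: "real^2" and \<mu> :: "real \<Rightarrow> real^2"
  assumes "symmetric_matrix A0" and "sym_pos_def E" and "sym_pos_def B"
    and "solves_R A0 E B a1 a2 l0 u0"
    and "invertible (jacobian (R_map A0 E B a1 a2 l0) (at u0))"
    and "l0 \<in> interior D"
    and "continuous_on D \<mu>"
    and "\<mu> l0 = u0"
    and "\<And>t. t \<in> D \<Longrightarrow> solves_R A0 E B a1 a2 t (\<mu> t)"
    and "l \<in> D"
  shows "let g = (\<lambda>i j. G A0 E B a1 a2 l $ i $ j);
             h = (\<lambda>i j. H A0 E a1 a2 l $ i $ j);
             \<mu>1 = \<mu> l $ 1;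
             \<mu>2 = \<mu> l $ 2;
             \<gamma> = \<mu>1 ^ 2
         in \<gamma> ^ 3 * ((h 1 2) ^ 2 * g 1 1 - 2 * h 1 2 * h 1 1 * g 1 2 + (h 1 1) ^ 2 * g 2 2)
              + \<gamma> ^ 2 * (2 * h 1 2 * g 1 2 - 2 * h 1 1 * g 2 2)
              + \<gamma> * g 2 2 - (h 1 2) ^ 2 = 0
            \<and> \<mu>1 - h 1 1 * \<mu>1 ^ 3 = h 1 2 * \<mu>2 ^ 3"
proof -
  have sol: "solves_R A0 E B a1 a2 l (\<mu> l)"
    using assms by blast
  have "symmetric_matrix (G A0 E B a1 a2 l)"
    using assms(1-3) sol by (auto intro: symmetric_G simp: sym_pos_def_def solves_R_def)
  note quad = R_scalar_eq_0_iff[OF this, THEN iffD1]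
  have lin: "H A0 E a1 a2 l $ 1 $ 1 * (\<mu> l $ 1) ^ 3 + H A0 E a1 a2 l $ 1 $ 2 * (\<mu> l $ 2) ^ 3
      = \<mu> l $ 1"
    using sol by (simp add: solves_R_def R_proj_eq_0_iff)
  show ?thesis
    unfolding Let_def
  proof (rule conjI[OF cubic_of_eliminating_second_variable[OF lin quad]])
    show "R_scalar A0 E B a1 a2 l (\<mu> l) = 0"
      using sol by (simp add: solves_R_def)
  qed (use lin in \<open>simp add: algebra_simps\<close>)
qed

end
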